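(* Let $V:\mathbb{R}^d\to\mathbb{R}$ be continuously differentiable, bounded from below and coercive, and let $\overline{\nabla}V:\mathbb{R}^d\times\mathbb{R}^d\to\mathbb{R}^d$ be a discrete gradient of $V$. Let $0<c\le M<\infty$ be constants and let $(\tau_n)_{n\ge 0}$ be real numbers with $c\le\tau_n\le M$ for all $n$. If $\{x_n\}_{n=0}^\infty\subset\mathbb{R}^d$ is a sequence generated by the discrete gradient method, i.e. $x_{n+1}-x_n=-\tau_n\overline{\nabla}V(x_n,x_{n+1})$ for all $n\ge 0$, then \[ \lim_{n\to\infty}\overline{\nabla}V(x_{n+1},x_n)=\lim_{n\to\infty}\nabla V(x_n)=0 . \] Moreover, the sequence $\{x_n\}_{n=0}^\infty$ has at least one accumulation point, and every accumulation point $x_*$ of $\{x_n\}_{n=0}^\infty$ satisfies $\nabla V(x_* )=0$.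
   Context: $\mathbb{R}^d$ carries the standard inner product $\langle\cdot,\cdot\rangle$ and its norm $\|\cdot\|$; $\nabla V$ is the usual gradient. Discrete gradient: for a continuously differentiable $V:\mathbb{R}^d\to\mathbb{R}$, a function $\overline{\nabla}V:\mathbb{R}^d\times\mathbb{R}^d\to\mathbb{R}^d$ is a discrete gradient of $V$ iff it is continuous and, for all $x,x'\in\mathbb{R}^d$, $\langle\overline{\nabla}V(x,x'),x'-x\rangle=V(x')-V(x)$ and $\overline{\nabla}V(x,x)=\nabla V(x)$. (It need not be symmetric in its two arguments.) Coercive: $V(x_n)\to\infty$ whenever $\|x_n\|\to\infty$. Bounded from below: there is a constant $C$ with $C\le V(x)$ for all $x\in\mathbb{R}^d$. *)

theory Defs
  imports "HOL-Analysis.Analysis"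
begin

definition gradient :: "('a::euclidean_space \<Rightarrow> real) \<Rightarrow> 'a \<Rightarrow> 'a" where
  "gradient V x = (THE D. GDERIV V x :> D)"

lemma GDERIV_unique:
  assumes "GDERIV V x :> D" "GDERIV V x :> E"
  shows "D = E"
proof -
  have "(\<lambda>h. inner h D) = (\<lambda>h. inner h E)"
    using assms has_derivative_unique unfolding gderiv_def by blast
  then show ?thesis
    by (metis inner_commute vector_eq_rdot)
qed

text \<open>The description in \<^const>\<open>gradient\<close> is meaningful wherever the function is differentiable.\<close>

lemma GDERIV_gradient:
  fixes V :: "'a::euclidean_space \<Rightarrow> real"
  assumes "V differentiable (at x)"
  shows "GDERIV V x :> gradient V x"
proof -
  obtain L where L: "(V has_derivative L) (at x)"
    using assms by (auto simp: differentiable_def)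
  then interpret linear L by (rule has_derivative_linear)
  have "L h = inner h (adjoint L 1)" for h
    using adjoint_works[OF linear_axioms, of h 1] by simp
  then have "L = (\<lambda>h. inner h (adjoint L 1))" by blast
  with L have "GDERIV V x :> adjoint L 1"
    unfolding gderiv_def by metis
  then show ?thesis
    unfolding gradient_def by (rule theI) (rule GDERIV_unique[OF _ \<open>GDERIV V x :> adjoint L 1\<close>])
qed

definition continuously_differentiable :: "('a::euclidean_space \<Rightarrow> real) \<Rightarrow> bool" where
  "continuously_differentiable V \<longleftrightarrow>
     (\<forall>x. V differentiable (at x)) \<and> continuous_on UNIV (gradient V)"

definition discrete_gradient ::
    "('a::euclidean_space \<Rightarrow> real) \<Rightarrow> ('a \<times> 'a \<Rightarrow> 'a) \<Rightarrow> bool" where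
  "discrete_gradient V G \<longleftrightarrow>
     continuous_on UNIV G \<and>
     (\<forall>x x'. inner (G (x, x')) (x' - x) = V x' - V x) \<and>
     (\<forall>x. G (x, x) = gradient V x)"

definition coercive :: "('a::euclidean_space \<Rightarrow> real) \<Rightarrow> bool" where
  "coercive V \<longleftrightarrow>
     (\<forall>x :: nat \<Rightarrow> 'a. filterlim (\<lambda>n. norm (x n)) at_top sequentially \<longrightarrow>
        filterlim (\<lambda>n. V (x n)) at_top sequentially)"

text \<open>An accumulation point of a sequence is a limit of a subsequence. It need not be a limit
  point of the range: the limit of an eventually constant sequence is an accumulation point.\<close>

definition accumulation_point :: "(nat \<Rightarrow> 'a::topological_space) \<Rightarrow> 'a \<Rightarrow> bool" where
  "accumulation_point x a \<longleftrightarrow> (\<exists>r. strict_mono r \<and> (x \<circ> r) \<longlonglongrightarrow> a)"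

end

theory Submission
  imports Defs
begin

text \<open>Along the iteration the energy drops by \<open>\<tau>\<^sub>n \<parallel>G(x\<^sub>n, x\<^sub>n\<^sub>+\<^sub>1)\<parallel>\<^sup>2\<close> in each step, so, being
  bounded below, it converges and both the increments and the discrete gradients tend to zero.
  Coercivity confines the iterates to a compact set, on which the discrete gradient is uniformly
  continuous; hence swapping its arguments, or making them equal, changes it by a vanishing
  amount.\<close>

text \<open>Otherwise the sublevel set contains points \<open>y n\<close> of norm above
  \<open>n\<close>, and coercivity along this sequence forces \<open>V (y n)\<close> past
  \<open>a\<close>. This turns the sequential definition into confinement of the iterates.\<close>

lemma coercive_bounded_sublevel:
  fixes V :: "'a::euclidean_space \<Rightarrow> real"
  assumes "coercive V"
  shows "bounded {y. V y \<le> a}"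
proof (rule ccontr)
  assume "\<not> bounded {y. V y \<le> a}"
  then have "\<exists>y. V y \<le> a \<and> real n < norm y" for n :: nat
    by (auto simp: bounded_iff not_le)
  then obtain y where y: "\<And>n. V (y n) \<le> a" "\<And>n. real n < norm (y n)"
    by metis
  have "filterlim (\<lambda>n. norm (y n)) at_top sequentially"
    by (rule filterlim_at_top_mono[OF filterlim_real_sequentially])
      (use y(2) in \<open>auto intro!: always_eventually less_imp_le\<close>)
  then have "filterlim (\<lambda>n. V (y n)) at_top sequentially"
    using assms unfolding coercive_def by blast
  then have "eventually (\<lambda>n. a < V (y n)) sequentially"
    by (simp add: filterlim_at_top_dense)
  then obtain n where "a < V (y n)"
    by (auto simp: eventually_sequentially)
  with y(1)[of n] show False
    by simp
qed

text \<open>Both sequences lie in one compact set, where \<open>G\<close> is uniformly continuous by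
  Heine-Cantor. In the theorem, \<open>u\<close> and \<open>v\<close> are sequences of pairs of
  iterates.\<close>

lemma continuous_diff_tendsto_0:
  fixes G :: "'a::heine_borel \<Rightarrow> 'b::real_normed_vector"
  assumes "continuous_on UNIV G" "bounded (range u)" "bounded (range v)"
    and "(\<lambda>n. dist (u n) (v n)) \<longlonglongrightarrow> 0"
  shows "(\<lambda>n. G (u n) - G (v n)) \<longlonglongrightarrow> 0"
proof -
  let ?K = "closure (range u \<union> range v)"
  have "compact ?K"
    using assms(2,3) by (simp add: compact_Un)
  then have "uniformly_continuous_on ?K G"
    using assms(1) by (meson compact_uniformly_continuous continuous_on_subset subset_UNIV)
  moreover have "u n \<in> ?K" "v n \<in> ?K" for n
    by (auto intro: closure_subset[THEN subsetD])
  ultimately have "(\<lambda>n. dist (G (u n)) (G (v n))) \<longlonglongrightarrow> 0"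
    using assms(4) unfolding uniformly_continuous_on_sequentially by blast
  then show ?thesis
    by (simp add: dist_norm tendsto_norm_zero_iff)
qed

theorem theorem3p2:
  fixes V :: "real ^ 'd \<Rightarrow> real"
    and G :: "(real ^ 'd) \<times> (real ^ 'd) \<Rightarrow> real ^ 'd"
    and c M :: real
    and \<tau> :: "nat \<Rightarrow> real"
    and x :: "nat \<Rightarrow> real ^ 'd"
  assumes "continuously_differentiable V"
    and "bdd_below (range V)"
    and "coercive V"
    and "discrete_gradient V G"
    and "0 < c" and "c \<le> M"
    and "\<And>n. c \<le> \<tau> n \<and> \<tau> n \<le> M"
    and "\<And>n. x (Suc n) - x n = - (\<tau> n *\<^sub>R G (x n, x (Suc n)))"
  shows "(\<lambda>n. G (x (Suc n), x n)) \<longlonglongrightarrow> 0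
    \<and> (\<lambda>n. gradient V (x n)) \<longlonglongrightarrow> 0
    \<and> (\<exists>a. accumulation_point x a)
    \<and> (\<forall>a. accumulation_point x a \<longrightarrow> gradient V a = 0)"
proof -
  have contG: "continuous_on UNIV G"
    and mean: "\<And>y z. inner (G (y, z)) (z - y) = V z - V y"
    and diag: "\<And>y. G (y, y) = gradient V y"
    using assms(4) by (auto simp: discrete_gradient_def)
  define g where "g n = G (x n, x (Suc n))" for n
  have step: "x (Suc n) - x n = - (\<tau> n *\<^sub>R g n)" for n
    using assms(8) by (simp add: g_def)
  \<comment> \<open>The mean value identity, with the increment replaced by
    \<open>- (\<tau> n *\<^sub>R g n)\<close>.\<close>
  have drop: "V (x n) - V (x (Suc n)) = \<tau> n * (norm (g n))\<^sup>2" for n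
    using mean[of "x n" "x (Suc n)"] by (simp add: step dot_square_norm flip: g_def)
  have lower: "c * (norm (g n))\<^sup>2 \<le> V (x n) - V (x (Suc n))" for n
    unfolding drop using assms(7) by (intro mult_right_mono) auto
  have dec: "decseq (\<lambda>n. V (x n))"
  proof (rule decseq_SucI)
    show "V (x (Suc n)) \<le> V (x n)" for n
      using lower[of n] assms(5) by (smt (verit) mult_nonneg_nonneg zero_le_power2)
  qed
  obtain B where "\<And>y. B \<le> V y"
    using assms(2) by (auto simp: bdd_below_def)
  then obtain L where L: "(\<lambda>n. V (x n)) \<longlonglongrightarrow> L"
    using decseq_convergent[OF dec] by metis
  have "(\<lambda>n. V (x n) - V (x (Suc n))) \<longlonglongrightarrow> L - L"
    by (intro tendsto_diff L LIMSEQ_Suc)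
  then have "(\<lambda>n. (V (x n) - V (x (Suc n))) / c) \<longlonglongrightarrow> 0"
    by (intro tendsto_divide_zero) simp
  \<comment> \<open>The uniform bound \<open>c\<close> on the step sizes from below lets the
    vanishing energy drop, divided by \<open>c\<close>, dominate the squared norm.\<close>
  then have "(\<lambda>n. (norm (g n))\<^sup>2) \<longlonglongrightarrow> 0"
  proof (rule tendsto_sandwich[OF _ _ tendsto_const, rotated 2])
    show "\<forall>\<^sub>F n in sequentially. (norm (g n))\<^sup>2 \<le> (V (x n) - V (x (Suc n))) / c"
      using lower assms(5) by (simp add: pos_le_divide_eq mult.commute)
  qed simp
  then have g0: "g \<longlonglongrightarrow> 0"
    by (simp add: tendsto_norm_zero_iff)
  \<comment> \<open>Here the upper bound \<open>M\<close> enters: small discrete gradients give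
    small increments only if the step sizes stay bounded.\<close>
  have "(\<lambda>n. M * norm (g n)) \<longlonglongrightarrow> 0"
    using g0 by (intro tendsto_mult_right_zero tendsto_norm_zero)
  moreover have "norm (x (Suc n) - x n) \<le> M * norm (g n)" for n
    unfolding step using assms(7)[of n] assms(5) by (auto intro: mult_right_mono)
  ultimately have incr: "(\<lambda>n. norm (x (Suc n) - x n)) \<longlonglongrightarrow> 0"
    by - (rule tendsto_norm_zero, rule Lim_null_comparison[where g = "\<lambda>n. M * norm (g n)"], auto)

  have "range x \<subseteq> {y. V y \<le> V (x 0)}"
    using dec by (auto simp: decseq_def)
  then have bx: "bounded (range x)"
    using coercive_bounded_sublevel[OF assms(3)] bounded_subset by blast
  have bp: "bounded (range (\<lambda>n. (x (i n), x (j n))))" for i j :: "nat \<Rightarrow> nat"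
    by (rule bounded_subset[OF bounded_Times[OF bx bx]]) auto

  \<comment> \<open>Swapping moves both components by the length of the increment, so the distance
    is the square root of twice its square.\<close>
  have "(\<lambda>n. dist (x (Suc n), x n) (x n, x (Suc n))) \<longlonglongrightarrow> 0"
    using tendsto_real_sqrt[OF tendsto_add[OF tendsto_power[OF incr, of 2] tendsto_power[OF incr, of 2]]]
    unfolding dist_Pair_Pair by (simp add: dist_norm norm_minus_commute[of "x n" "x (Suc n)" for n])
  then have "(\<lambda>n. G (x (Suc n), x n) - g n) \<longlonglongrightarrow> 0"
    unfolding g_def
    using continuous_diff_tendsto_0[OF contG bp[of Suc "\<lambda>n. n"] bp[of "\<lambda>n. n" Suc]] by blast
  from tendsto_add[OF this g0] have swapped: "(\<lambda>n. G (x (Suc n), x n)) \<longlonglongrightarrow> 0"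
    by simp

  \<comment> \<open>Only the second component differs, so the distance is the length of the
    increment; \<open>diag\<close> then reads \<open>gradient V (x n)\<close> as
    \<open>G (x n, x n)\<close>.\<close>
  have "(\<lambda>n. dist (x n, x n) (x n, x (Suc n))) \<longlonglongrightarrow> 0"
    using incr unfolding dist_Pair_Pair by (simp add: dist_norm norm_minus_commute[of "x n" "x (Suc n)" for n])
  then have "(\<lambda>n. gradient V (x n) - g n) \<longlonglongrightarrow> 0"
    unfolding g_def diag[symmetric]
    using continuous_diff_tendsto_0[OF contG bp[of "\<lambda>n. n" "\<lambda>n. n"] bp[of "\<lambda>n. n" Suc]] by blast
  from tendsto_add[OF this g0] have grad: "(\<lambda>n. gradient V (x n)) \<longlonglongrightarrow> 0"
    by simp

  have "\<exists>a. accumulation_point x a"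
    using bounded_imp_convergent_subsequence[OF bx] unfolding accumulation_point_def by metis
  moreover have "gradient V a = 0" if acc: "accumulation_point x a" for a
  proof -
    obtain r where r: "strict_mono r" "(x \<circ> r) \<longlonglongrightarrow> a"
      using acc unfolding accumulation_point_def by blast
    \<comment> \<open>Continuity of the gradient gives one limit along the subsequence,
      \<open>grad\<close> gives the limit 0, and the two must agree.\<close>
    have "(\<lambda>n. gradient V ((x \<circ> r) n)) \<longlonglongrightarrow> gradient V a"
      using assms(1) r(2) unfolding continuously_differentiable_def
      by (intro continuous_on_tendsto_compose[of UNIV "gradient V"]) (auto simp: o_def)
    moreover have "(\<lambda>n. gradient V ((x \<circ> r) n)) \<longlonglongrightarrow> 0"
      using LIMSEQ_subseq_LIMSEQ[OF grad r(1)] by (simp add: o_def)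
    ultimately show ?thesis
      by (rule LIMSEQ_unique)
  qed
  ultimately show ?thesis
    using swapped grad by blast
qed

end
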